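(* Let Algorithm 1 (described in the context) be run with parameters $\alpha=1$ and $\mu=\frac{3-\sqrt5}{2}\approx 0.382$. Then Algorithm 1 is $\frac{2}{3-\sqrt5}$-competitive, where $\frac{2}{3-\sqrt5}<2.62$, for task graphs following the roofline speedup model. That is, for every number $P\ge 1$ of processors and every finite directed acyclic graph of moldable tasks all of which follow the roofline model, i.e. $t_j(p)=\frac{w_j}{\min(p,\bar p_j)}$ with $\bar p_j\le P$, the makespan $T$ produced by the algorithm satisfies $T\le \frac{2}{3-\sqrt5}\,T^{\mathrm{opt}}$, where $T^{\mathrm{opt}}$ is the optimal offline makespan.
   Context: Problem. A finite DAG $G=(V,E)$ of tasks is to be executed on $P$ identical processors. An edge $(i,j)$ means that task $j$ cannot start before task $i$ is completed. Tasks are moldable: when task $j$ starts, an integer number $p\in\{1,\dots,P\}$ of processors is chosen for it; it then runs without interruption on exactly $p$ processors for time $t_j(p)$. At any time at most $P$ processors are in use. Online setting: a task becomes available (and its parameters become known) only when all its predecessors are completed. The makespan is the completion time of the last task; $T^{\mathrm{opt}}$ is the minimum makespan over all feasible (offline) schedules. Roofline model: $t_j(p)=\frac{w_j}{\min(p,\bar p_j)}$ with $w_j>0$ real and $1\le\bar p_j\le P$ an integer. The area is $a_j(p)=p\,t_j(p)$. Put $p_j^{\max}=\bar p_j$, $t_j^{\min}=t_j(p_j^{\max})$, $a_j^{\min}=a_j(1)$. Algorithm 1 with parameters $\alpha\ge1$, $\mu\in(0,1/2]$. Processor allocation: when task $j$ becomes available, (Step 1) choose an initial allocation $p_j\in\{1,\dots,p_j^{\max}\}$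 minimizing $t_j(p)/t_j^{\min}$ subject to $a_j(p)/a_j^{\min}\le\alpha$; (Step 2) the final allocation is $p_j'=\min(p_j,\lceil\mu P\rceil)$. The task is then inserted into a waiting queue (in arbitrary order). List scheduling: at time $0$ and whenever a running task completes, after newly available tasks have been inserted, scan all tasks in the queue and start each task $j$ immediately on $p'_j$ processors if at least $p'_j$ processors are idle. *)

theory Defs
  imports Complex_Main
begin

record 'a moldable_graph =
  tasks :: "'a set"
  edges :: "('a \<times> 'a) set"
  exec_time :: "'a \<Rightarrow> nat \<Rightarrow> real"
  max_alloc :: "'a \<Rightarrow> nat"

definition dag :: "'a moldable_graph \<Rightarrow> bool" where
  "dag G \<longleftrightarrow> finite (tasks G) \<and> edges G \<subseteq> tasks G \<times> tasks G \<and> acyclic (edges G)"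

definition area :: "'a moldable_graph \<Rightarrow> 'a \<Rightarrow> nat \<Rightarrow> real" where
  "area G j p = real p * exec_time G j p"

definition min_time :: "'a moldable_graph \<Rightarrow> 'a \<Rightarrow> real" where
  "min_time G j = exec_time G j (max_alloc G j)"

definition min_area :: "'a moldable_graph \<Rightarrow> 'a \<Rightarrow> real" where
  "min_area G j = area G j 1"

definition roofline :: "nat \<Rightarrow> 'a moldable_graph \<Rightarrow> bool" where
  "roofline P G \<longleftrightarrow> (\<forall>j\<in>tasks G. \<exists>w pbar. w > 0 \<and> 1 \<le> pbar \<and> pbar \<le> P \<and>
     (\<forall>p\<in>{1..P}. exec_time G j p = w / real (min p pbar)) \<and> max_alloc G j = pbar)"


subsection \<open>Offline schedules\<close>

text \<open>A schedule is given by a start time \<open>s j\<close> and an allocation \<open>q j\<close> for every task \<open>j\<close>;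
  task \<open>j\<close> occupies its processors during the half-open interval from \<open>s j\<close> to its completion.
  Values outside \<open>tasks G\<close> are irrelevant.\<close>

definition completion :: "'a moldable_graph \<Rightarrow> ('a \<Rightarrow> real) \<Rightarrow> ('a \<Rightarrow> nat) \<Rightarrow> 'a \<Rightarrow> real" where
  "completion G s q j = s j + exec_time G j (q j)"

definition feasible ::
    "nat \<Rightarrow> 'a moldable_graph \<Rightarrow> ('a \<Rightarrow> real) \<Rightarrow> ('a \<Rightarrow> nat) \<Rightarrow> bool" where
  "feasible P G s q \<longleftrightarrow>
     (\<forall>j\<in>tasks G. 0 \<le> s j \<and> q j \<in> {1..P}) \<and>
     (\<forall>(i, j)\<in>edges G. completion G s q i \<le> s j) \<and>
     (\<forall>\<tau>. (\<Sum>j | j \<in> tasks G \<and> s j \<le> \<tau> \<and> \<tau> < completion G s q j. q j) \<le> P)"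

text \<open>Inserting \<open>0\<close> only matters for the empty graph, whose makespan is thereby \<open>0\<close>.\<close>

definition makespan :: "'a moldable_graph \<Rightarrow> ('a \<Rightarrow> real) \<Rightarrow> ('a \<Rightarrow> nat) \<Rightarrow> real" where
  "makespan G s q = Max (insert 0 (completion G s q ` tasks G))"

definition opt_makespan :: "nat \<Rightarrow> 'a moldable_graph \<Rightarrow> real" where
  "opt_makespan P G = Inf {makespan G s q | s q. feasible P G s q}"


subsection \<open>Processor allocation\<close>

definition initial_alloc :: "real \<Rightarrow> 'a moldable_graph \<Rightarrow> 'a \<Rightarrow> nat \<Rightarrow> bool" where
  "initial_alloc \<alpha> G j =
     is_arg_min (\<lambda>p. exec_time G j p / min_time G j)
       (\<lambda>p. p \<in> {1..max_alloc G j} \<and> area G j p / min_area G j \<le> \<alpha>)"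

definition final_alloc :: "real \<Rightarrow> real \<Rightarrow> nat \<Rightarrow> 'a moldable_graph \<Rightarrow> 'a \<Rightarrow> nat \<Rightarrow> bool" where
  "final_alloc \<alpha> \<mu> P G j p' \<longleftrightarrow>
     (\<exists>p. initial_alloc \<alpha> G j p \<and> p' = min p (nat \<lceil>\<mu> * real P\<rceil>))"


subsection \<open>Online list scheduling\<close>

text \<open>The state right after an event has been processed: the tasks completed so far, the waiting
  queue, and the start times of all tasks started so far.\<close>

record 'a sched_state =
  finished :: "'a set"
  queue :: "'a list"
  start :: "'a \<Rightarrow> real option"

definition running :: "'a sched_state \<Rightarrow> 'a set" where
  "running S = dom (start S) - finished S"

definition available :: "'a moldable_graph \<Rightarrow> 'a set \<Rightarrow> 'a set" where
  "available G F = {j \<in> tasks G. \<forall>i. (i, j) \<in> edges G \<longrightarrow> i \<in> F}"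

text \<open>\<open>scan P q u Q\<close> traverses the queue \<open>Q\<close> while \<open>u\<close> processors are in use, and returns the list
  of tasks to be started and the list of tasks that remain in the queue.\<close>

fun scan :: "nat \<Rightarrow> ('a \<Rightarrow> nat) \<Rightarrow> nat \<Rightarrow> 'a list \<Rightarrow> 'a list \<times> 'a list" where
  "scan P q u [] = ([], [])"
| "scan P q u (j # Q) =
     (if u + q j \<le> P
      then (case scan P q (u + q j) Q of (A, R) \<Rightarrow> (j # A, R))
      else (case scan P q u Q of (A, R) \<Rightarrow> (A, j # R)))"

definition start_tasks ::
    "nat \<Rightarrow> ('a \<Rightarrow> nat) \<Rightarrow> real \<Rightarrow> 'a sched_state \<Rightarrow> 'a sched_state" where
  "start_tasks P q \<tau> S =
     (case scan P q (\<Sum>j\<in>running S. q j) (queue S) of (A, R) \<Rightarrow>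
        S\<lparr>queue := R, start := (\<lambda>j. if j \<in> set A then Some \<tau> else start S j)\<rparr>)"

text \<open>The states reached by list scheduling with allocation \<open>q\<close>. The list \<open>N\<close> enumerates the
  newly available tasks in any order, and \<open>shuffles\<close> lets them enter the queue at any positions.
  All tasks completing at the same time \<open>\<tau>\<close> are handled in one event.\<close>

inductive list_schedule ::
    "nat \<Rightarrow> 'a moldable_graph \<Rightarrow> ('a \<Rightarrow> nat) \<Rightarrow> 'a sched_state \<Rightarrow> bool"
  for P G q where
  init: "distinct N \<Longrightarrow> set N = available G {} \<Longrightarrow>
     list_schedule P G q
       (start_tasks P q 0 \<lparr>finished = {}, queue = N, start = Map.empty\<rparr>)"
| event: "list_schedule P G q S \<Longrightarrow> running S \<noteq> {} \<Longrightarrow>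
     \<tau> = Min (completion G (the \<circ> start S) q ` running S) \<Longrightarrow>
     C = {j \<in> running S. completion G (the \<circ> start S) q j = \<tau>} \<Longrightarrow>
     distinct N \<Longrightarrow>
     set N = available G (finished S \<union> C) - available G (finished S) \<Longrightarrow>
     Q \<in> shuffles (queue S) N \<Longrightarrow>
     list_schedule P G q
       (start_tasks P q \<tau> \<lparr>finished = finished S \<union> C, queue = Q, start = start S\<rparr>)"

text \<open>\<open>algorithm1 \<alpha> \<mu> P G s q\<close>: some run of the algorithm ends with the schedule \<open>(s, q)\<close>.
  A run ends as soon as no task is running. That every task has been started by then is not
  part of the definition.\<close>

definition algorithm1 ::
    "real \<Rightarrow> real \<Rightarrow> nat \<Rightarrow> 'a moldable_graph \<Rightarrow> ('a \<Rightarrow> real) \<Rightarrow> ('a \<Rightarrow> nat) \<Rightarrow> bool" where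
  "algorithm1 \<alpha> \<mu> P G s q \<longleftrightarrow>
     (\<forall>j\<in>tasks G. final_alloc \<alpha> \<mu> P G j (q j)) \<and>
     (\<exists>S. list_schedule P G q S \<and> running S = {} \<and> s = the \<circ> start S)"

text \<open>The algorithm always produces a schedule, so quantifying over all of them is not vacuous.\<close>

lemma set_scan: "set (fst (scan P q u Q)) \<union> set (snd (scan P q u Q)) = set Q"
  by (induction Q arbitrary: u) (simp_all add: case_prod_unfold)

lemma start_tasks_subset:
  "finished (start_tasks P q t S) = finished S"
  "set (queue (start_tasks P q t S)) \<subseteq> set (queue S)"
  "dom (start (start_tasks P q t S)) \<subseteq> dom (start S) \<union> set (queue S)"
  using set_scan[of P q "\<Sum>j\<in>running S. q j" "queue S"]
  by (auto simp: start_tasks_def case_prod_unfold split: if_splits)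

lemma list_schedule_terminates:
  assumes "finite (tasks G)" "list_schedule P G q S"
    "dom (start S) \<subseteq> tasks G" "set (queue S) \<subseteq> tasks G" "finished S \<subseteq> tasks G"
  shows "\<exists>S'. list_schedule P G q S' \<and> running S' = {}"
  using assms(2-)
proof (induction "card (tasks G - finished S)" arbitrary: S rule: less_induct)
  case less
  show ?case
  proof (cases "running S = {}")
    case True then show ?thesis using less by blast
  next
    case False
    define \<tau> where "\<tau> = Min (completion G (the \<circ> start S) q ` running S)"
    define C where "C = {j \<in> running S. completion G (the \<circ> start S) q j = \<tau>}"
    have run: "running S \<subseteq> tasks G" using less.prems by (auto simp: running_def)
    then have fin: "finite (running S)" using assms(1) finite_subset by blast
    have "\<tau> \<in> completion G (the \<circ> start S) q ` running S"
      unfolding \<tau>_def using fin False by (intro Min_in) auto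
    then have C: "C \<noteq> {}" by (auto simp: C_def)
    have av: "available G F \<subseteq> tasks G" for F by (auto simp: available_def)
    have "finite (available G (finished S \<union> C) - available G (finished S))"
      using av assms(1) finite_subset by (meson finite_Diff)
    then obtain N where N: "distinct N" "set N = available G (finished S \<union> C) - available G (finished S)"
      using finite_distinct_list by blast
    obtain Q where Q: "Q \<in> shuffles (queue S) N" using splice_in_shuffles by blast
    let ?T = "\<lparr>finished = finished S \<union> C, queue = Q, start = start S\<rparr>"
    let ?S = "start_tasks P q \<tau> ?T"
    have ls: "list_schedule P G q ?S"
      using list_schedule.event[OF less.prems(1) False \<tau>_def C_def N Q] .
    have QN: "set Q = set (queue S) \<union> set N" using Q set_shuffles by blast
    have Qt: "set Q \<subseteq> tasks G" using QN N av less.prems by blast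
    have f: "finished ?S = finished S \<union> C" by (simp add: start_tasks_subset(1))
    have q: "set (queue ?S) \<subseteq> tasks G" using start_tasks_subset(2)[of P q \<tau> ?T] Qt by auto
    have d: "dom (start ?S) \<subseteq> tasks G" using start_tasks_subset(3)[of P q \<tau> ?T] Qt less.prems by auto
    have Ct: "C \<subseteq> tasks G" "C \<inter> finished S = {}" using run by (auto simp: C_def running_def)
    have "card (tasks G - finished ?S) < card (tasks G - finished S)"
      using assms(1) C Ct unfolding f by (intro psubset_card_mono) auto
    moreover have "finished ?S \<subseteq> tasks G" using f Ct less.prems(4) by auto
    ultimately show ?thesis using less.hyps ls d q by blast
  qed
qed

lemma algorithm1_run_exists:
  assumes "dag G" "roofline P G" "\<alpha> \<ge> 1"
  shows "\<exists>s q. algorithm1 \<alpha> \<mu> P G s q"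
proof -
  have "\<exists>p. initial_alloc \<alpha> G j p" if j: "j \<in> tasks G" for j
  proof -
    obtain w pbar where r: "w > 0" "1 \<le> pbar" "pbar \<le> P" "\<forall>p\<in>{1..P}. exec_time G j p = w / real (min p pbar)"
       "max_alloc G j = pbar" using assms(2) j unfolding roofline_def by blast
    have e1: "exec_time G j 1 = w" using r by (auto simp: min_def)
    let ?X = "{p. p \<in> {1..max_alloc G j} \<and> area G j p / min_area G j \<le> \<alpha>}"
    have "1 \<in> ?X" using r e1 assms(3) by (auto simp: area_def min_area_def)
    then have "finite ?X" "?X \<noteq> {}" by auto
    from ex_is_arg_min_if_finite[OF this, of "\<lambda>p. exec_time G j p / min_time G j"]
    show ?thesis unfolding initial_alloc_def is_arg_min_def by auto
  qed
  then have "\<forall>j\<in>tasks G. \<exists>p. final_alloc \<alpha> \<mu> P G j p" by (auto simp: final_alloc_def)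
  then obtain q where q: "\<forall>j\<in>tasks G. final_alloc \<alpha> \<mu> P G j (q j)" by metis
  have fin: "finite (tasks G)" using assms(1) by (simp add: dag_def)
  have av: "available G {} \<subseteq> tasks G" by (auto simp: available_def)
  then obtain N where N: "distinct N" "set N = available G {}"
    using fin finite_distinct_list finite_subset by metis
  let ?T = "\<lparr>finished = {}, queue = N, start = Map.empty\<rparr>"
  let ?S = "start_tasks P q 0 ?T"
  have "dom (start ?S) \<subseteq> tasks G" "set (queue ?S) \<subseteq> tasks G" "finished ?S \<subseteq> tasks G"
    using start_tasks_subset[of P q 0 ?T] N av by auto
  from list_schedule_terminates[OF fin list_schedule.init[OF N] this] q show ?thesis unfolding algorithm1_def by blast
qed

end

(* At every moment either no task is waiting, and then all available tasks run, so
   the critical path shrinks at a rate rho (1 if every running task is uncapped; otherwise at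
   least mu, with at least mu P processors busy), or more than (1 - mu) P processors are busy. With u busy processors one gets
   rho + u / ((1 - mu) P) >= 1 in all cases, since mu + mu / (1 - mu) >= 1. Integrating over time
   bounds the makespan by the critical path length plus the total area divided by (1 - mu) P.
   Roofline areas do not grow up to the maximal useful allocation, so both are bounded by the
   optimum M, and T <= (1 + 1 / (1 - mu)) M = M / mu.
   Instead of following a critical path explicitly, the progress is measured against an arbitrary
   feasible schedule: an unfinished task j that has received a fraction x of its work certifies the
   progress s j + x * min_time j. *)
theory Submission
  imports "HOL-Analysis.Analysis" Defs
begin

section \<open>Offline schedules\<close>

lemma roofline_exec_time:
  assumes "roofline P G" "j \<in> tasks G" "p \<in> {1..P}"
  shows "exec_time G j p = exec_time G j 1 / real (min p (max_alloc G j))"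
proof -
  obtain w where w: "1 \<le> max_alloc G j" "max_alloc G j \<le> P"
      "\<forall>p\<in>{1..P}. exec_time G j p = w / real (min p (max_alloc G j))"
    using assms(1,2) unfolding roofline_def by blast
  then have "exec_time G j 1 = w"
    by (auto simp: min_def)
  then show ?thesis
    using w assms(3) by blast
qed

lemma roofline_bounds:
  assumes "roofline P G" "j \<in> tasks G"
  shows "1 \<le> max_alloc G j" "max_alloc G j \<le> P" "0 < exec_time G j 1"
proof -
  obtain w where w: "w > 0" "1 \<le> max_alloc G j" "max_alloc G j \<le> P"
      "\<forall>p\<in>{1..P}. exec_time G j p = w / real (min p (max_alloc G j))"
    using assms unfolding roofline_def by blast
  show "1 \<le> max_alloc G j" "max_alloc G j \<le> P" by (fact w)+
  have "exec_time G j 1 = w"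
    using w by (auto simp: min_def)
  then show "0 < exec_time G j 1" using w by simp
qed

lemma roofline_exec_time_pos:
  assumes "roofline P G" "j \<in> tasks G" "p \<in> {1..P}"
  shows "0 < exec_time G j p"
  using roofline_exec_time[OF assms] roofline_bounds[OF assms(1,2)] assms(3) by simp

lemma roofline_min_time_le:
  assumes "roofline P G" "j \<in> tasks G" "p \<in> {1..P}"
  shows "min_time G j \<le> exec_time G j p"
proof -
  note b = roofline_bounds[OF assms(1,2)]
  have "exec_time G j (max_alloc G j) = exec_time G j 1 / real (max_alloc G j)"
    using roofline_exec_time[OF assms(1,2), of "max_alloc G j"] b by simp
  also have "\<dots> \<le> exec_time G j 1 / real (min p (max_alloc G j))"
    using b assms(3) by (intro divide_left_mono) auto
  also have "\<dots> = exec_time G j p"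
    using roofline_exec_time[OF assms] by simp
  finally show ?thesis by (simp add: min_time_def)
qed

text \<open>Using \<open>p\<close> processors speeds a task up by a factor of at most
  \<open>p\<close>.\<close>

lemma roofline_min_area_le:
  assumes "roofline P G" "j \<in> tasks G" "p \<in> {1..P}"
  shows "min_area G j \<le> area G j p"
proof -
  have "exec_time G j 1 * real (min p (max_alloc G j)) \<le> exec_time G j 1 * real p"
    using roofline_bounds[OF assms(1,2)] by (intro mult_left_mono) auto
  then show ?thesis
    using roofline_exec_time[OF assms] roofline_bounds[OF assms(1,2)] assms(3)
    by (simp add: min_area_def area_def pos_le_divide_eq)
qed

section \<open>Makespan and total area of a schedule\<close>

lemma completion_le_makespan:
  assumes "finite (tasks G)" "j \<in> tasks G"
  shows "completion G s q j \<le> makespan G s q"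
  unfolding makespan_def using assms by (intro Max_ge) auto

lemma makespan_nonneg: "finite (tasks G) \<Longrightarrow> 0 \<le> makespan G s q"
  unfolding makespan_def by (intro Max_ge) auto

lemma makespan_le_iff:
  "finite (tasks G) \<Longrightarrow> makespan G s q \<le> T \<longleftrightarrow> 0 \<le> T \<and> (\<forall>j\<in>tasks G. completion G s q j \<le> T)"
  by (auto simp: makespan_def)

text \<open>The total area is the integral over time of the number of busy processors, which is at
  most \<open>P\<close> before the makespan and zero outside that window.\<close>

lemma total_area_le:
  assumes fin: "finite (tasks G)" and feas: "feasible P G s q"
    and nonneg: "\<And>j. j \<in> tasks G \<Longrightarrow> 0 \<le> exec_time G j (q j)"
  shows "(\<Sum>j\<in>tasks G. area G j (q j)) \<le> real P * makespan G s q"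
proof -
  let ?c = "completion G s q" and ?M = "makespan G s q"
  let ?f = "\<lambda>\<tau>. \<Sum>j\<in>tasks G. real (q j) * indicator {s j..<?c j} \<tau>"
  have sc: "s j \<le> ?c j" if "j \<in> tasks G" for j
    using nonneg[OF that] by (simp add: completion_def)
  have int: "integrable lborel (\<lambda>\<tau>. real (q j) * indicator {s j..<?c j} \<tau>)"
      if "j \<in> tasks G" for j
    using sc[OF that] by (intro integrable_mult_right integrable_real_indicator) auto
  have "(\<Sum>j\<in>tasks G. area G j (q j)) = (\<Sum>j\<in>tasks G. integral\<^sup>L lborel (\<lambda>\<tau>. real (q j) * indicator {s j..<?c j} \<tau>))"
    using sc by (intro sum.cong) (auto simp: area_def completion_def)
  also have "\<dots> = integral\<^sup>L lborel ?f"
    using int by (intro Bochner_Integration.integral_sum[symmetric]) auto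
  also have "\<dots> \<le> integral\<^sup>L lborel (\<lambda>\<tau>. real P * indicator {0..<?M} \<tau>)"
  proof (rule integral_mono)
    show "integrable lborel ?f" using int by (intro Bochner_Integration.integrable_sum) auto
    show "integrable lborel (\<lambda>\<tau>. real P * indicator {0..<?M} \<tau>)"
      using makespan_nonneg[OF fin, of s q]
      by (intro integrable_mult_right integrable_real_indicator) auto
    fix \<tau> :: real
    have "?f \<tau> = (\<Sum>j\<in>tasks G. if s j \<le> \<tau> \<and> \<tau> < ?c j then real (q j) else 0)"
      by (intro sum.cong) auto
    also have "\<dots> = (\<Sum>j | j \<in> tasks G \<and> s j \<le> \<tau> \<and> \<tau> < ?c j. real (q j))"
      using fin by (subst sum.inter_filter[symmetric]) auto
    finally have f: "?f \<tau> = \<dots>" .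
    show "?f \<tau> \<le> real P * indicator {0..<?M} \<tau>"
    proof (cases "\<tau> \<in> {0..<?M}")
      case True
      have "(\<Sum>j | j \<in> tasks G \<and> s j \<le> \<tau> \<and> \<tau> < ?c j. q j) \<le> P"
        using feas unfolding feasible_def by blast
      then show ?thesis using True f by (simp flip: of_nat_sum)
    next
      case False
      have "\<tau> \<in> {0..<?M}" if "j \<in> tasks G" "s j \<le> \<tau>" "\<tau> < ?c j" for j
        using feas that completion_le_makespan[OF fin that(1), of s q] unfolding feasible_def by force
      then have "{j. j \<in> tasks G \<and> s j \<le> \<tau> \<and> \<tau> < ?c j} = {}" using False by blast
      then show ?thesis using False f by simp
    qed
  qed
  also have "\<dots> = real P * ?M"
    using makespan_nonneg[OF fin, of s q] by simp
  finally show ?thesis .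
qed

section \<open>Topological order and existence of a feasible schedule\<close>

lemma acyclic_ex_ranking:
  assumes "finite A" "acyclic r"
  shows "\<exists>f :: 'a \<Rightarrow> nat. inj_on f A \<and> (\<forall>i\<in>A. \<forall>j\<in>A. (i, j) \<in> r \<longrightarrow> f i < f j)"
  using assms(1)
proof (induction "card A" arbitrary: A rule: less_induct)
  case less
  show ?case
  proof (cases "A = {}")
    case False
    have "acyclic (r \<inter> A \<times> A)"
      using assms(2) by (rule acyclic_subset) auto
    moreover have "finite (r \<inter> A \<times> A)" using less.prems by blast
    \<comment> \<open>A minimal element for the converse relation has no successor in
      \<open>A\<close>. It is removed, and afterwards ranked above everything else.\<close>
    ultimately have wf: "wf ((r \<inter> A \<times> A)\<inverse>)" by (intro finite_acyclic_wf_converse)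
    obtain a where "a \<in> A" using False by blast
    then obtain m where m: "m \<in> A" "\<And>j. (j, m) \<in> (r \<inter> A \<times> A)\<inverse> \<Longrightarrow> j \<notin> A"
      by (rule wfE_min[OF wf]) blast
    then have sink: "(m, j) \<notin> r" if "j \<in> A" for j using that by blast
    have "card (A - {m}) < card A" using m(1) less.prems by (intro card_Diff1_less)
    then obtain f :: "'a \<Rightarrow> nat" where f: "inj_on f (A - {m})"
        "\<forall>i\<in>A - {m}. \<forall>j\<in>A - {m}. (i, j) \<in> r \<longrightarrow> f i < f j"
      using less.hyps[of "A - {m}"] less.prems by blast
    obtain b where b: "\<forall>i\<in>A. f i < b"
      using less.prems finite_nat_set_iff_bounded[of "f ` A"] by auto
    have "inj_on (f(m := b)) A"
      using f(1) b by (fastforce simp: inj_on_def)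
    moreover have "\<forall>i\<in>A. \<forall>j\<in>A. (i, j) \<in> r \<longrightarrow> (f(m := b)) i < (f(m := b)) j"
      using f(2) b sink by auto
    ultimately show ?thesis by blast
  qed simp
qed

text \<open>Tasks are run one after another on a single processor, in a topological order.\<close>

lemma ex_feasible:
  assumes "dag G" "roofline P G" "P \<ge> 1"
  shows "\<exists>s q. feasible P G s q"
proof -
  have fin: "finite (tasks G)" and edge: "edges G \<subseteq> tasks G \<times> tasks G"
    using assms(1) by (auto simp: dag_def)
  obtain f :: "'a \<Rightarrow> nat" where f: "inj_on f (tasks G)"
      "\<forall>i\<in>tasks G. \<forall>j\<in>tasks G. (i, j) \<in> edges G \<longrightarrow> f i < f j"
    using acyclic_ex_ranking assms(1) unfolding dag_def by blast
  define s where "s j = (\<Sum>i | i \<in> tasks G \<and> f i < f j. exec_time G i 1)" for j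
  let ?c = "completion G s (\<lambda>_. 1)"
  have w: "exec_time G j 1 > 0" if "j \<in> tasks G" for j
    using roofline_bounds(3)[OF assms(2) that] .
  have le: "?c i \<le> s j" if "i \<in> tasks G" "f i < f j" for i j
  proof -
    have "?c i = (\<Sum>k\<in>insert i {k \<in> tasks G. f k < f i}. exec_time G k 1)"
      using fin by (simp add: completion_def s_def)
    also have "\<dots> \<le> s j"
      unfolding s_def using fin that w by (intro sum_mono2) (auto intro: less_imp_le)
    finally show ?thesis .
  qed
  \<comment> \<open>Of two tasks with different ranks one completes before the other starts, so at
    most one task is active at any time.\<close>
  have cap: "(\<Sum>j | j \<in> tasks G \<and> s j \<le> \<tau> \<and> \<tau> < ?c j. 1) \<le> P" for \<tau>
  proof -
    let ?X = "{j. j \<in> tasks G \<and> s j \<le> \<tau> \<and> \<tau> < ?c j}"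
    have "i = j" if X: "i \<in> ?X" "j \<in> ?X" for i j
    proof (rule inj_onD[OF f(1)])
      have "\<not> f i < f j" "\<not> f j < f i"
        using le[of i j] le[of j i] X by fastforce+
      then show "f i = f j" by simp
    qed (use X in auto)
    moreover have "finite ?X" using fin by simp
    ultimately have "card ?X \<le> Suc 0"
      by (subst card_le_Suc0_iff_eq) blast+
    then show ?thesis using assms(3) by simp
  qed
  have "0 \<le> s j" for j
    unfolding s_def using w by (intro sum_nonneg) (auto intro: less_imp_le)
  then have "feasible P G s (\<lambda>_. 1)"
    unfolding feasible_def
  proof (intro conjI ballI allI)
    fix e assume e: "e \<in> edges G"
    then show "case e of (i, j) \<Rightarrow> ?c i \<le> s j"
      using le f(2) edge by (cases e) blast
  qed (use cap assms(3) in simp_all)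
  then show ?thesis by blast
qed

text \<open>A lower bound passes to a real infimum only over a nonempty set, hence the appeal to
  \<open>ex_feasible\<close>.\<close>

lemma le_opt_makespan:
  assumes "dag G" "roofline P G" "P \<ge> 1"
    and "\<And>s q. feasible P G s q \<Longrightarrow> T \<le> makespan G s q"
  shows "T \<le> opt_makespan P G"
  unfolding opt_makespan_def using ex_feasible[OF assms(1-3)] assms(4)
  by (intro cInf_greatest) auto

section \<open>Processor allocation\<close>

text \<open>Area is constant up to \<open>max_alloc G j\<close>, so even the bound 1 admits every
  allocation in that range; time strictly decreases there, so the minimiser is
  \<open>max_alloc G j\<close> itself.\<close>

lemma final_alloc_roofline:
  assumes "roofline P G" "j \<in> tasks G" "final_alloc 1 \<mu> P G j p"
  shows "p = min (max_alloc G j) (nat \<lceil>\<mu> * real P\<rceil>)"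
proof -
  let ?b = "max_alloc G j" and ?w = "exec_time G j 1"
  note b = roofline_bounds[OF assms(1,2)]
  obtain p0 where p0: "initial_alloc 1 G j p0" "p = min p0 (nat \<lceil>\<mu> * real P\<rceil>)"
    using assms(3) unfolding final_alloc_def by blast
  have e: "exec_time G j k = ?w / real k" if "k \<in> {1..?b}" for k
    using roofline_exec_time[OF assms(1,2), of k] that b by (simp add: min_def)
  have p0b: "p0 \<in> {1..?b}"
    using p0(1) unfolding initial_alloc_def is_arg_min_def by blast
  have "area G j ?b / min_area G j \<le> 1"
    using e[of ?b] b by (simp add: area_def min_area_def)
  then have "\<not> exec_time G j ?b / min_time G j < exec_time G j p0 / min_time G j"
    using p0(1) b unfolding initial_alloc_def is_arg_min_def by auto
  moreover have "min_time G j > 0"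
    using e[of ?b] b by (simp add: min_time_def)
  ultimately have "exec_time G j p0 \<le> exec_time G j ?b"
    by (metis divide_strict_right_mono not_less)
  then have "?w / real p0 \<le> ?w / real ?b"
    using e[of ?b] e[OF p0b] b by simp
  then have "real ?b \<le> real p0"
    using b p0b by (simp add: field_simps)
  then show ?thesis using p0 p0b by simp
qed

section \<open>List scheduling\<close>

text \<open>Usage only grows during a scan, so a task that is rejected once does not fit at the end
  either.\<close>

lemma scan_maximal:
  "j \<in> set (snd (scan P q u Q)) \<Longrightarrow> P < u + sum_list (map q (fst (scan P q u Q))) + q j"
  by (induction Q arbitrary: u) (fastforce simp: case_prod_unfold split: if_splits)+

text \<open>Stated for multisets so that distinctness of the queue passes to both output lists and
  makes them disjoint.\<close>

lemma mset_scan: "mset (fst (scan P q u Q)) + mset (snd (scan P q u Q)) = mset Q"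
  by (induction Q arbitrary: u) (simp_all add: case_prod_unfold)

text \<open>Processing time received up to \<tau>. The default 0 and the cap at the execution time
  let one formula cover unstarted, running and finished tasks.\<close>

definition elapsed :: "'a moldable_graph \<Rightarrow> ('a \<Rightarrow> nat) \<Rightarrow> ('a \<Rightarrow> real option) \<Rightarrow> real \<Rightarrow> 'a \<Rightarrow> real" where
  "elapsed G q st \<tau> j = (case st j of None \<Rightarrow> 0 | Some s \<Rightarrow> min (\<tau> - s) (exec_time G j (q j)))"


text \<open>The quadratic condition on \<mu> is equivalent to \<mu> + \<mu> / (1 - \<mu>) \<ge> 1;
  the \<mu> of the theorem satisfies it with equality.\<close>

locale capped_roofline =
  fixes P :: nat and G :: "'a moldable_graph" and \<mu> :: real and q :: "'a \<Rightarrow> nat"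
  assumes P: "P \<ge> 1" and dag: "dag G" and roofline: "roofline P G"
    and \<mu>: "0 < \<mu>" "\<mu> < 1" "(1 - \<mu>)\<^sup>2 \<le> \<mu>"
    and alloc: "\<And>j. j \<in> tasks G \<Longrightarrow> q j = min (max_alloc G j) (nat \<lceil>\<mu> * real P\<rceil>)"
begin

lemma finite_tasks: "finite (tasks G)"
  using dag by (simp add: dag_def)

lemma cap_ge_1: "nat \<lceil>\<mu> * real P\<rceil> \<ge> 1"
proof -
  have "0 < \<mu> * real P" using P \<mu> by simp
  then show ?thesis by linarith
qed

lemma q_bounds:
  assumes "j \<in> tasks G"
  shows "1 \<le> q j" "q j \<le> max_alloc G j" "q j \<le> P" "q j \<le> nat \<lceil>\<mu> * real P\<rceil>"
  using alloc[OF assms] roofline_bounds[OF roofline assms] cap_ge_1 by auto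

lemma exec_time_q:
  assumes "j \<in> tasks G"
  shows "exec_time G j (q j) = exec_time G j 1 / real (q j)" "0 < exec_time G j (q j)"
  using roofline_exec_time[OF roofline assms, of "q j"] roofline_exec_time_pos[OF roofline assms, of "q j"]
    q_bounds[OF assms] by (simp_all add: min_def)

lemma elapsed_le: "j \<in> tasks G \<Longrightarrow> elapsed G q st \<theta> j \<le> exec_time G j (q j)"
  using exec_time_q(2)[of j] by (simp add: elapsed_def split: option.split)

text \<open>Critical-path progress per unit of running time: a complete run on \<open>q j\<close>
  processors earns exactly \<open>min_time G j\<close>.\<close>

definition speed :: "'a \<Rightarrow> real" where
  "speed j = real (q j) / real (max_alloc G j)"

lemma speed_nonneg: "0 \<le> speed j"
  by (simp add: speed_def)

lemma speed_exec_time: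
  assumes "j \<in> tasks G"
  shows "speed j * exec_time G j (q j) = min_time G j"
  using roofline_exec_time[OF roofline assms, of "max_alloc G j"] roofline_bounds[OF roofline assms]
    exec_time_q[OF assms] q_bounds[OF assms] by (simp add: speed_def min_time_def)

text \<open>Only the cap can slow a task down, and the cap is at least \<mu> P, while
  \<open>max_alloc G j\<close> is at most \<open>P\<close>.\<close>

lemma speed_ge:
  assumes "j \<in> tasks G"
  shows "\<mu> \<le> speed j"
proof (cases "q j = max_alloc G j")
  case True
  then show ?thesis using \<mu> q_bounds[OF assms] by (simp add: speed_def)
next
  case False
  have "\<mu> * real (max_alloc G j) \<le> \<mu> * real P"
    using roofline_bounds[OF roofline assms] \<mu> by (intro mult_left_mono) auto
  also have "\<dots> \<le> real (nat \<lceil>\<mu> * real P\<rceil>)"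
    by linarith
  also have "\<dots> = real (q j)"
    using False alloc[OF assms] by auto
  finally show ?thesis
    using roofline_bounds[OF roofline assms] by (simp add: speed_def field_simps)
qed

lemma speed_eq_1:
  assumes "j \<in> tasks G" "q j < nat \<lceil>\<mu> * real P\<rceil>"
  shows "speed j = 1"
  using assms alloc[OF assms(1)] q_bounds[OF assms(1)] by (auto simp: speed_def min_def split: if_splits)

text \<open>Here \<open>Q\<close> and \<open>R\<close> are the waiting and the running tasks, and \<open>\<rho>\<close> is the rate of progress on the
  critical path. The cases are: a task is waiting; no task is waiting and some running task hits
  the cap; no task is waiting and every running task has its maximal useful allocation.\<close>

lemma progress_or_utilisation:
  assumes "Q \<subseteq> tasks G" "R \<subseteq> tasks G"
    and full: "\<And>j. j \<in> Q \<Longrightarrow> P < (\<Sum>i\<in>R. q i) + q j"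
  obtains \<rho> where "0 \<le> \<rho>" "\<And>j. j \<in> R \<Longrightarrow> \<rho> \<le> speed j" "Q \<noteq> {} \<Longrightarrow> \<rho> = 0"
    "1 \<le> \<rho> + real (\<Sum>i\<in>R. q i) / ((1 - \<mu>) * real P)"
proof -
  let ?u = "\<Sum>i\<in>R. q i"
  have P0: "real P > 0" using P by simp
  consider (wait) j where "j \<in> Q" | (wide) j where "Q = {}" "j \<in> R" "nat \<lceil>\<mu> * real P\<rceil> \<le> q j"
    | (narrow) "Q = {}" "\<forall>j\<in>R. q j < nat \<lceil>\<mu> * real P\<rceil>"
    by (meson all_not_in_conv not_less)
  then show thesis
  proof cases
    case wait
    have "P < ?u + nat \<lceil>\<mu> * real P\<rceil>"
      using full[OF wait] q_bounds(4)[of j] wait assms(1) by fastforce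
    \<comment> \<open>Integrality turns the strict inequality into a gain of 1, which absorbs the
      rounding of the ceiling.\<close>
    then have "real P + 1 \<le> real ?u + real (nat \<lceil>\<mu> * real P\<rceil>)"
      by linarith
    moreover have "real (nat \<lceil>\<mu> * real P\<rceil>) < \<mu> * real P + 1"
      using mult_pos_pos[OF \<mu>(1) P0] by linarith
    ultimately have "(1 - \<mu>) * real P \<le> real ?u"
      by (simp add: left_diff_distrib)
    then have "1 \<le> 0 + real ?u / ((1 - \<mu>) * real P)"
      using P0 \<mu> by (simp add: pos_le_divide_eq)
    then show thesis
      using speed_nonneg by (intro that[of 0]) auto
  next
    case wide
    have "q j \<le> ?u"
      using wide(2) assms(2) finite_tasks finite_subset by (intro member_le_sum) auto
    then have "\<mu> * real P \<le> real ?u"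
      using wide(3) by linarith
    \<comment> \<open>The capped task alone keeps \<mu> P processors busy; the quadratic condition
      makes this enough to cover the missing rate 1 - \<mu>.\<close>
    moreover have "(1 - \<mu>) * ((1 - \<mu>) * real P) \<le> \<mu> * real P"
      using mult_right_mono[OF \<mu>(3), of "real P"] by (simp add: power2_eq_square)
    ultimately have "(1 - \<mu>) * ((1 - \<mu>) * real P) \<le> real ?u"
      by linarith
    then have "1 - \<mu> \<le> real ?u / ((1 - \<mu>) * real P)"
      using P0 \<mu> by (subst pos_le_divide_eq) auto
    then show thesis
      using wide(1) assms(2) \<mu> speed_ge by (intro that[of \<mu>]) auto
  next
    case narrow
    have "0 \<le> real ?u / ((1 - \<mu>) * real P)"
      using \<mu> by (intro divide_nonneg_nonneg mult_nonneg_nonneg of_nat_0_le_iff) auto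
    then show thesis
      using narrow assms(2) speed_eq_1 by (intro that[of 1]) auto
  qed
qed

text \<open>Meant to hold both before and after the queue is scanned at time \<tau>. The strict
  inequality for running tasks says that all completions at \<tau> have been processed, so the next
  event is strictly later.\<close>

definition schedule_inv :: "real \<Rightarrow> 'a sched_state \<Rightarrow> bool" where
  "schedule_inv \<tau> S \<longleftrightarrow>
     finished S \<subseteq> dom (start S) \<and> dom (start S) \<subseteq> available G (finished S) \<and>
     distinct (queue S) \<and> set (queue S) = available G (finished S) - dom (start S) \<and>
     (\<forall>j s. start S j = Some s \<longrightarrow> s \<le> \<tau>) \<and>
     (\<forall>j\<in>finished S. completion G (the \<circ> start S) q j \<le> \<tau>) \<and>
     (\<forall>j\<in>running S. \<tau> < completion G (the \<circ> start S) q j)"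

lemma available_subset: "available G F \<subseteq> tasks G"
  by (auto simp: available_def)

section \<open>Starting tasks from the queue\<close>

context
  fixes \<tau> S
  assumes inv: "schedule_inv \<tau> S"
begin

lemma running_subset: "running S \<subseteq> tasks G"
  using inv available_subset unfolding schedule_inv_def running_def by blast

text \<open>Packages the scan for the proofs below; the sum in the last clause already counts the
  tasks just started.\<close>

lemma start_tasks_cases:
  obtains A R where "start_tasks P q \<tau> S =
      S\<lparr>queue := R, start := (\<lambda>j. if j \<in> set A then Some \<tau> else start S j)\<rparr>"
    "distinct A" "distinct R" "set A \<inter> set R = {}" "set A \<union> set R = set (queue S)"
    "\<And>j. j \<in> set R \<Longrightarrow> P < (\<Sum>i\<in>running S \<union> set A. q i) + q j"
proof -
  obtain A R where AR: "scan P q (\<Sum>j\<in>running S. q j) (queue S) = (A, R)"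
    by fastforce
  have m: "mset (A @ R) = mset (queue S)"
    using mset_scan[of P q "\<Sum>j\<in>running S. q j" "queue S"] AR by simp
  have d: "distinct (A @ R)"
    using m inv mset_eq_imp_distinct_iff unfolding schedule_inv_def by blast
  have st: "set (A @ R) = set (queue S)"
    using m mset_eq_setD by blast
  have dj: "running S \<inter> set A = {}"
    using st inv unfolding schedule_inv_def running_def by auto
  have "finite (running S)"
    using running_subset finite_tasks by (rule finite_subset)
  then have "(\<Sum>i\<in>running S \<union> set A. q i) = (\<Sum>i\<in>running S. q i) + sum_list (map q A)"
    using dj d by (simp add: sum.union_disjoint sum_list_distinct_conv_sum_set)
  then show thesis
    using that[of A R] scan_maximal[of _ P q "\<Sum>j\<in>running S. q j" "queue S"] AR d st
    by (simp add: start_tasks_def)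
qed

lemma schedule_inv_start_tasks: "schedule_inv \<tau> (start_tasks P q \<tau> S)"
proof -
  obtain A R where AR: "start_tasks P q \<tau> S =
      S\<lparr>queue := R, start := (\<lambda>j. if j \<in> set A then Some \<tau> else start S j)\<rparr>"
    "distinct R" "set A \<inter> set R = {}" "set A \<union> set R = set (queue S)"
    by (rule start_tasks_cases) blast
  have A: "set A \<subseteq> available G (finished S)" "set A \<inter> dom (start S) = {}"
    using AR(4) inv unfolding schedule_inv_def by blast+
  let ?st = "\<lambda>j. if j \<in> set A then Some \<tau> else start S j"
  have dom: "dom ?st = set A \<union> dom (start S)"
    by (auto split: if_splits)
  have old: "(the \<circ> ?st) j = (the \<circ> start S) j" if "j \<in> dom (start S)" for j
    using A(2) that by auto
  have "finished S \<subseteq> dom ?st" "dom ?st \<subseteq> available G (finished S)"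
    "set R = available G (finished S) - dom ?st"
    using inv A AR(3,4) unfolding dom schedule_inv_def by blast+
  moreover have "t \<le> \<tau>" if "?st j = Some t" for j t
    using inv that unfolding schedule_inv_def by (auto split: if_splits)
  moreover have "completion G (the \<circ> ?st) q j \<le> \<tau>" if "j \<in> finished S" for j
  proof -
    have "j \<in> dom (start S)" "completion G (the \<circ> start S) q j \<le> \<tau>"
      using inv that unfolding schedule_inv_def by blast+
    then show ?thesis unfolding completion_def using old by simp
  qed
  moreover have "\<tau> < completion G (the \<circ> ?st) q j" if "j \<in> dom ?st - finished S" for j
  proof (cases "j \<in> set A")
    \<comment> \<open>A task started now completes strictly later because execution times are
      positive.\<close>
    case True
    then show ?thesis
      using exec_time_q(2)[of j] A(1) available_subset by (auto simp: completion_def)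
  next
    case False
    then have "j \<in> running S" using that unfolding dom running_def by blast
    then have "\<tau> < completion G (the \<circ> start S) q j"
      using inv unfolding schedule_inv_def by blast
    then show ?thesis using False by (simp add: completion_def)
  qed
  ultimately show ?thesis
    using AR(1,2) unfolding schedule_inv_def running_def by simp
qed

lemma queue_start_tasks:
  assumes "j \<in> set (queue (start_tasks P q \<tau> S))"
  shows "P < (\<Sum>i\<in>running (start_tasks P q \<tau> S). q i) + q j"
proof -
  obtain A R where AR: "start_tasks P q \<tau> S =
      S\<lparr>queue := R, start := (\<lambda>j. if j \<in> set A then Some \<tau> else start S j)\<rparr>"
    "set A \<union> set R = set (queue S)"
    "\<And>j. j \<in> set R \<Longrightarrow> P < (\<Sum>i\<in>running S \<union> set A. q i) + q j"
    by (rule start_tasks_cases) blast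
  have "set A \<inter> finished S = {}"
    using AR(2) inv unfolding schedule_inv_def by blast
  then have "running (start_tasks P q \<tau> S) = running S \<union> set A"
    by (auto simp: AR(1) running_def split: if_splits)
  then show ?thesis using AR assms by simp
qed

text \<open>A task started at this very moment has received no processing time, which agrees with
  the default for unstarted tasks.\<close>

lemma elapsed_start_tasks: "elapsed G q (start (start_tasks P q \<tau> S)) \<tau> = elapsed G q (start S) \<tau>"
proof
  fix j
  obtain A R where AR: "start_tasks P q \<tau> S =
      S\<lparr>queue := R, start := (\<lambda>j. if j \<in> set A then Some \<tau> else start S j)\<rparr>"
    "set A \<union> set R = set (queue S)"
    by (rule start_tasks_cases) blast
  have "j \<in> tasks G" "start S j = None" if "j \<in> set A"
    using AR(2) that inv available_subset unfolding schedule_inv_def by blast+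
  then show "elapsed G q (start (start_tasks P q \<tau> S)) \<tau> j = elapsed G q (start S) \<tau> j"
    using exec_time_q(2)[of j] by (auto simp: AR(1) elapsed_def)
qed

lemma running_ancestor:
  assumes "queue S = []" "feasible P G s p" "j \<in> tasks G" "j \<notin> dom (start S)"
  obtains i where "i \<in> running S" "s i + min_time G i \<le> s j"
proof -
  have edge: "edges G \<subseteq> tasks G \<times> tasks G" and "acyclic (edges G)"
    using dag by (auto simp: dag_def)
  then have "wf (edges G)"
    using finite_tasks by (intro finite_acyclic_wf) (auto intro: finite_subset)
  then have "j \<in> tasks G \<longrightarrow> j \<notin> dom (start S) \<longrightarrow> (\<exists>i\<in>running S. s i + min_time G i \<le> s j)"
  proof (induction j rule: wf_induct_rule)
    case (less j)
    show ?case
    proof (intro impI)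
      assume j: "j \<in> tasks G" "j \<notin> dom (start S)"
      then have "j \<notin> available G (finished S)"
        using inv assms(1) unfolding schedule_inv_def by auto
      then obtain i where i: "(i, j) \<in> edges G" "i \<notin> finished S"
        using j(1) unfolding available_def by blast
      have it: "i \<in> tasks G" using i(1) edge by blast
      have pi: "p i \<in> {1..P}"
        using assms(2) it unfolding feasible_def by blast
      have ij: "s i + exec_time G i (p i) \<le> s j"
        using assms(2) i(1) unfolding feasible_def completion_def by auto
      note t = roofline_min_time_le[OF roofline it pi] roofline_exec_time_pos[OF roofline it pi]
      show "\<exists>i\<in>running S. s i + min_time G i \<le> s j"
      proof (cases "i \<in> dom (start S)")
        case True
        then show ?thesis using i t ij by (intro bexI[of _ i]) (auto simp: running_def)
      next
        case False
        then obtain k where "k \<in> running S" "s k + min_time G k \<le> s i"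
          using less i it by blast
        then show ?thesis using t ij by (intro bexI[of _ k]) auto
      qed
    qed
  qed
  then show thesis using assms that by blast
qed

end

text \<open>\<open>D\<close> is the progress so far on the critical path, measured against the start times \<open>s\<close> of a
  reference schedule of makespan \<open>M\<close>. Time not accounted for by \<open>D\<close> is charged to the area processed so far.\<close>

definition charged :: "('a \<Rightarrow> real) \<Rightarrow> real \<Rightarrow> real \<Rightarrow> real \<Rightarrow> 'a sched_state \<Rightarrow> bool" where
  "charged s M D \<tau> S \<longleftrightarrow> D \<le> M \<and>
     (\<forall>j\<in>tasks G - finished S. D \<le> s j + speed j * elapsed G q (start S) \<tau> j) \<and>
     \<tau> \<le> D + (\<Sum>j\<in>tasks G. real (q j) * elapsed G q (start S) \<tau> j) / ((1 - \<mu>) * real P)"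

lemma charged_start_tasks:
  assumes "schedule_inv \<tau> S"
  shows "charged s M D \<tau> (start_tasks P q \<tau> S) \<longleftrightarrow> charged s M D \<tau> S"
  by (simp add: charged_def elapsed_start_tasks[OF assms] start_tasks_subset(1))

section \<open>Advancing to the next completion\<close>

context
  fixes S \<tau> \<tau>' C
  assumes inv: "schedule_inv \<tau> S" and ne: "running S \<noteq> {}"
    and \<tau>'_def: "\<tau>' = Min (completion G (the \<circ> start S) q ` running S)"
    and C_def: "C = {j \<in> running S. completion G (the \<circ> start S) q j = \<tau>'}"
begin

lemma finite_running: "finite (running S)"
  using running_subset[OF inv] finite_tasks by (rule finite_subset)

lemma next_event_le: "j \<in> running S \<Longrightarrow> \<tau>' \<le> completion G (the \<circ> start S) q j"
  unfolding \<tau>'_def using finite_running by (intro Min_le) auto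

lemma next_event_greater: "\<tau> < \<tau>'"
  unfolding \<tau>'_def using finite_running ne inv by (subst Min_gr_iff) (auto simp: schedule_inv_def)

text \<open>Finished tasks have reached the cap in \<open>elapsed\<close>, and no running task
  reaches it before \<tau>'.\<close>

lemma elapsed_next_event:
  "elapsed G q (start S) \<tau>' j = elapsed G q (start S) \<tau> j + (if j \<in> running S then \<tau>' - \<tau> else 0)"
proof (cases "start S j")
  case None
  then show ?thesis by (auto simp: elapsed_def running_def)
next
  case (Some s)
  show ?thesis
  proof (cases "j \<in> finished S")
    case True
    then have "s + exec_time G j (q j) \<le> \<tau>"
      using inv Some by (auto simp: schedule_inv_def completion_def)
    then show ?thesis using True Some next_event_greater by (simp add: elapsed_def running_def)
  next
    case False
    then have "j \<in> running S" using Some by (auto simp: running_def)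
    then show ?thesis
      using Some next_event_le[of j] next_event_greater by (simp add: elapsed_def completion_def)
  qed
qed

lemma schedule_inv_event:
  assumes N: "distinct N" "set N = available G (finished S \<union> C) - available G (finished S)"
    and Q: "Q \<in> shuffles (queue S) N"
  shows "schedule_inv \<tau>' \<lparr>finished = finished S \<union> C, queue = Q, start = start S\<rparr>"
proof -
  let ?F = "finished S \<union> C"
  have C: "C \<subseteq> running S" by (auto simp: C_def)
  have mono: "available G (finished S) \<subseteq> available G ?F"
    by (auto simp: available_def)
  have "set (queue S) \<inter> set N = {}" "distinct (queue S)"
    using N inv unfolding schedule_inv_def by auto
  then have "distinct Q"
    using N(1) Q distinct_disjoint_shuffles by metis
  moreover have "set Q = available G ?F - dom (start S)"
    using set_shuffles[OF Q] N(2) inv mono unfolding schedule_inv_def by blast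
  moreover have "finished S \<union> C \<subseteq> dom (start S)"
    using C inv unfolding schedule_inv_def running_def by blast
  moreover have "dom (start S) \<subseteq> available G ?F"
    using inv mono unfolding schedule_inv_def by blast
  moreover have "t \<le> \<tau>'" if "start S j = Some t" for j t
    using inv that next_event_greater unfolding schedule_inv_def by force
  moreover have "completion G (the \<circ> start S) q j \<le> \<tau>'" if "j \<in> finished S \<union> C" for j
    using inv that next_event_greater unfolding schedule_inv_def C_def by fastforce
  moreover have "\<tau>' < completion G (the \<circ> start S) q j" if "j \<in> dom (start S) - (finished S \<union> C)" for j
    using that next_event_le[of j] unfolding C_def running_def by auto
  ultimately show ?thesis
    unfolding schedule_inv_def running_def by simp
qed

text \<open>The running set is constant between two events, so one rate \<rho> serves the whole
  interval and the new progress is D + \<rho> (\<tau>' - \<tau>).\<close>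

lemma charged_event:
  assumes feas: "feasible P G s p" and ch: "charged s (makespan G s p) D \<tau> S"
    and full: "\<And>j. j \<in> set (queue S) \<Longrightarrow> P < (\<Sum>i\<in>running S. q i) + q j"
  shows "\<exists>D'. charged s (makespan G s p) D' \<tau>' \<lparr>finished = finished S \<union> C, queue = Q, start = start S\<rparr>"
proof -
  let ?e = "elapsed G q (start S)" and ?\<delta> = "\<tau>' - \<tau>"
  have Qt: "set (queue S) \<subseteq> tasks G"
    using inv available_subset unfolding schedule_inv_def by blast
  obtain \<rho> where \<rho>: "0 \<le> \<rho>" "\<And>j. j \<in> running S \<Longrightarrow> \<rho> \<le> speed j" "set (queue S) \<noteq> {} \<Longrightarrow> \<rho> = 0"
      "1 \<le> \<rho> + real (\<Sum>i\<in>running S. q i) / ((1 - \<mu>) * real P)"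
    using progress_or_utilisation[OF Qt running_subset[OF inv] full] by blast
  have \<delta>: "0 \<le> ?\<delta>" using next_event_greater by simp
  have bound: "D \<le> s j + speed j * ?e \<tau> j" if "j \<in> tasks G" "j \<notin> finished S" for j
    using ch that unfolding charged_def by blast
  have run: "D + \<rho> * ?\<delta> \<le> s j + speed j * ?e \<tau>' j" if j: "j \<in> running S" for j
  proof -
    have "D \<le> s j + speed j * ?e \<tau> j"
      using bound j running_subset[OF inv] by (auto simp: running_def)
    moreover have "\<rho> * ?\<delta> \<le> speed j * ?\<delta>"
      using \<rho>(2)[OF j] \<delta> by (intro mult_right_mono)
    ultimately show ?thesis
      using j by (simp add: elapsed_next_event distrib_left)
  qed
  \<comment> \<open>A running task never earns more than its \<open>min_time\<close>. This bounds
    the new progress both by the reference makespan and for unstarted descendants.\<close>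
  have run': "D + \<rho> * ?\<delta> \<le> s j + min_time G j" if j: "j \<in> running S" for j
  proof -
    have "speed j * ?e \<tau>' j \<le> speed j * exec_time G j (q j)"
      using elapsed_le j running_subset[OF inv] speed_nonneg by (intro mult_left_mono) auto
    then show ?thesis
      using run[OF j] speed_exec_time[of j] j running_subset[OF inv] by auto
  qed
  have "D + \<rho> * ?\<delta> \<le> makespan G s p"
  proof -
    obtain j where j: "j \<in> running S" using ne by blast
    then have jt: "j \<in> tasks G" using running_subset[OF inv] by blast
    then have "p j \<in> {1..P}" using feas unfolding feasible_def by blast
    then have "s j + min_time G j \<le> completion G s p j"
      using roofline_min_time_le[OF roofline jt] by (simp add: completion_def)
    then show ?thesis
      using run'[OF j] completion_le_makespan[OF finite_tasks jt, of s p] by linarith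
  qed
  moreover have "D + \<rho> * ?\<delta> \<le> s j + speed j * ?e \<tau>' j" if j: "j \<in> tasks G" "j \<notin> finished S \<union> C" for j
  proof (cases "j \<in> running S")
    case False
    then have jd: "j \<notin> dom (start S)" using j by (auto simp: running_def)
    \<comment> \<open>With an empty queue, a running ancestor passes its bound on to
      \<open>j\<close>. Otherwise \<rho> = 0, so neither side of the old bound changes.\<close>
    show ?thesis
    proof (cases "queue S = []")
      case True
      then obtain i where "i \<in> running S" "s i + min_time G i \<le> s j"
        using running_ancestor[OF inv True feas j(1) jd] by blast
      moreover have "?e \<tau>' j = 0" using jd by (simp add: elapsed_def domIff)
      ultimately show ?thesis using run'[of i] by simp
    next
      case queue: False
      then show ?thesis
        using \<rho>(3) bound j False by (simp add: elapsed_next_event)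
    qed
  qed (rule run)
  moreover have "\<tau>' \<le> D + \<rho> * ?\<delta> + (\<Sum>j\<in>tasks G. real (q j) * ?e \<tau>' j) / ((1 - \<mu>) * real P)"
  proof -
    have "(\<Sum>j\<in>tasks G. real (q j) * ?e \<tau>' j) =
        (\<Sum>j\<in>tasks G. real (q j) * ?e \<tau> j) + (\<Sum>j\<in>tasks G. if j \<in> running S then ?\<delta> * real (q j) else 0)"
      unfolding sum.distrib[symmetric] by (intro sum.cong) (auto simp: elapsed_next_event algebra_simps)
    also have "(\<Sum>j\<in>tasks G. if j \<in> running S then ?\<delta> * real (q j) else 0) = ?\<delta> * real (\<Sum>j\<in>running S. q j)"
      using finite_tasks running_subset[OF inv]
      by (simp add: sum.inter_restrict[symmetric] Int_absorb1 sum_distrib_left)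
    finally have W: "(\<Sum>j\<in>tasks G. real (q j) * ?e \<tau>' j) =
        (\<Sum>j\<in>tasks G. real (q j) * ?e \<tau> j) + ?\<delta> * real (\<Sum>j\<in>running S. q j)" .
    \<comment> \<open>The rate inequality is integrated over the interval: each unit of time is paid
      for by progress or by area.\<close>
    have "?\<delta> \<le> ?\<delta> * (\<rho> + real (\<Sum>i\<in>running S. q i) / ((1 - \<mu>) * real P))"
      using mult_left_mono[OF \<rho>(4) \<delta>] by simp
    then show ?thesis
      using ch unfolding W charged_def add_divide_distrib by (simp add: algebra_simps)
  qed
  ultimately show ?thesis
    unfolding charged_def by (intro exI[of _ "D + \<rho> * ?\<delta>"]) auto
qed

end

section \<open>Invariants along a run and the makespan bound\<close>

lemma list_schedule_charged:
  assumes "list_schedule P G q S" and feas: "feasible P G s p"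
  shows "\<exists>\<tau> D. 0 \<le> \<tau> \<and> schedule_inv \<tau> S \<and> charged s (makespan G s p) D \<tau> S \<and>
    (\<forall>j\<in>set (queue S). P < (\<Sum>i\<in>running S. q i) + q j)"
  using assms(1)
proof induction
  case (init N)
  let ?S = "\<lparr>finished = {}, queue = N, start = Map.empty\<rparr>"
  have inv: "schedule_inv 0 ?S"
    using init by (simp add: schedule_inv_def running_def)
  \<comment> \<open>Initial progress 0 is certified by the nonnegative start times of the reference
    schedule.\<close>
  have "charged s (makespan G s p) 0 0 ?S"
    using feas makespan_nonneg[OF finite_tasks]
    by (simp add: charged_def elapsed_def feasible_def)
  then show ?case
    using schedule_inv_start_tasks[OF inv] queue_start_tasks[OF inv] charged_start_tasks[OF inv] by blast
next
  case (event S \<tau>' C N Q)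
  let ?S = "\<lparr>finished = finished S \<union> C, queue = Q, start = start S\<rparr>"
  obtain \<tau> D where \<tau>: "0 \<le> \<tau>" and S: "schedule_inv \<tau> S" "charged s (makespan G s p) D \<tau> S"
      "\<forall>j\<in>set (queue S). P < (\<Sum>i\<in>running S. q i) + q j"
    using event.IH by blast
  note ctxt = S(1) event.hyps(2-4)
  have inv: "schedule_inv \<tau>' ?S"
    using schedule_inv_event[OF ctxt event.hyps(5-7)] .
  obtain D' where "charged s (makespan G s p) D' \<tau>' ?S"
    using charged_event[OF ctxt feas S(2)] S(3) by blast
  moreover have "0 \<le> \<tau>'" using next_event_greater[OF ctxt] \<tau> by simp
  ultimately show ?case
    using schedule_inv_start_tasks[OF inv] queue_start_tasks[OF inv] charged_start_tasks[OF inv] by blast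
qed

lemma list_schedule_makespan_le:
  assumes ls: "list_schedule P G q S" and idle: "running S = {}" and feas: "feasible P G s p"
  shows "makespan G (the \<circ> start S) q \<le> (1 + 1 / (1 - \<mu>)) * makespan G s p"
proof -
  let ?M = "makespan G s p"
  obtain \<tau> D where \<tau>: "0 \<le> \<tau>" and inv: "schedule_inv \<tau> S" and ch: "charged s ?M D \<tau> S"
      and full: "\<forall>j\<in>set (queue S). P < (\<Sum>i\<in>running S. q i) + q j"
    using list_schedule_charged[OF ls feas] by blast
  have pP: "p j \<in> {1..P}" if "j \<in> tasks G" for j
    using feas that unfolding feasible_def by blast
  \<comment> \<open>On an idle machine a waiting task would need more than \<open>P\<close>
    processors, but \<open>q\<close> never exceeds \<open>P\<close>.\<close>
  have "queue S = []"
  proof (rule ccontr)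
    assume "queue S \<noteq> []"
    then have "hd (queue S) \<in> set (queue S)" by simp
    moreover from this have "hd (queue S) \<in> tasks G"
      using inv available_subset unfolding schedule_inv_def by blast
    ultimately show False
      using full q_bounds(3) idle by fastforce
  qed
  then have "tasks G \<subseteq> dom (start S)"
    using running_ancestor[OF inv _ feas] idle by blast
  then have "tasks G \<subseteq> finished S"
    using idle by (auto simp: running_def)
  then have "makespan G (the \<circ> start S) q \<le> \<tau>"
    using inv \<tau> unfolding makespan_le_iff[OF finite_tasks] schedule_inv_def by blast
  also have "\<tau> \<le> ?M + (\<Sum>j\<in>tasks G. real (q j) * elapsed G q (start S) \<tau> j) / ((1 - \<mu>) * real P)"
    using ch unfolding charged_def by linarith
  also have "\<dots> \<le> ?M + real P * ?M / ((1 - \<mu>) * real P)"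
  proof -
    \<comment> \<open>Since \<open>q j\<close> is at most \<open>max_alloc G j\<close>, its area
      equals the minimal area, which no allocation of the reference schedule can undercut.\<close>
    have "(\<Sum>j\<in>tasks G. real (q j) * elapsed G q (start S) \<tau> j) \<le> (\<Sum>j\<in>tasks G. area G j (p j))"
    proof (rule sum_mono)
      fix j assume j: "j \<in> tasks G"
      have "real (q j) * elapsed G q (start S) \<tau> j \<le> real (q j) * exec_time G j (q j)"
        using elapsed_le[OF j] by (intro mult_left_mono) auto
      also have "\<dots> = min_area G j"
        using exec_time_q(1)[OF j] q_bounds[OF j] by (simp add: min_area_def area_def)
      also have "\<dots> \<le> area G j (p j)"
        using roofline_min_area_le[OF roofline j pP[OF j]] .
      finally show "real (q j) * elapsed G q (start S) \<tau> j \<le> area G j (p j)" .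
    qed
    also have "\<dots> \<le> real P * ?M"
      using roofline_exec_time_pos[OF roofline _ pP] less_imp_le
      by (intro total_area_le[OF finite_tasks feas]) blast
    finally show ?thesis
      using \<mu> P by (intro add_left_mono divide_right_mono) auto
  qed
  also have "\<dots> = (1 + 1 / (1 - \<mu>)) * ?M"
    using P \<mu> by (simp add: field_simps)
  finally show ?thesis .
qed

end

theorem theorem1:
  "(\<forall>(P::nat) (G :: 'a moldable_graph) s q.
      P \<ge> 1 \<longrightarrow> dag G \<longrightarrow> roofline P G \<longrightarrow>
      algorithm1 1 ((3 - sqrt 5) / 2) P G s q \<longrightarrow>
      makespan G s q \<le> 2 / (3 - sqrt 5) * opt_makespan P G) \<and>
   2 / (3 - sqrt 5) < (2.62 :: real)"
proof (intro conjI allI impI)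
  define \<mu> :: real where "\<mu> = (3 - sqrt 5) / 2"
  \<comment> \<open>The upper bound gives 2 / (3 - 2.2364) < 2.62; the lower bound gives \<mu> <
    1.\<close>
  have r: "sqrt 5 < 2.2364" "2 < sqrt (5 :: real)"
    by (rule real_less_lsqrt, simp_all add: power2_eq_square) (rule real_less_rsqrt, simp)
  \<comment> \<open>Being a root of (1 - \<mu>)^2 = \<mu> is what collapses the ratio 1 + 1 / (1 -
    \<mu>) to 1 / \<mu>.\<close>
  have mu: "0 < \<mu>" "\<mu> < 1" "(1 - \<mu>)\<^sup>2 = \<mu>" "1 + 1 / (1 - \<mu>) = 1 / \<mu>" "2 / (3 - sqrt 5) = 1 / \<mu>"
    using r by (auto simp: \<mu>_def power2_eq_square field_simps)
  show "2 / (3 - sqrt 5) < (2.62 :: real)"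
    using r by (simp add: field_simps)
  fix P :: nat and G :: "'a moldable_graph" and s q
  assume PG: "P \<ge> 1" "dag G" "roofline P G" and "algorithm1 1 ((3 - sqrt 5) / 2) P G s q"
  then obtain S where alloc: "\<forall>j\<in>tasks G. final_alloc 1 \<mu> P G j (q j)"
      and S: "list_schedule P G q S" "running S = {}" "s = the \<circ> start S"
    unfolding algorithm1_def \<mu>_def by blast
  interpret capped_roofline P G \<mu> q
    using PG mu alloc final_alloc_roofline[OF PG(3)] by unfold_locales auto
  \<comment> \<open>The factor is moved to the left so that the claim is a lower bound on the
    infimum.\<close>
  have "\<mu> * makespan G s q \<le> opt_makespan P G"
  proof (rule le_opt_makespan[OF PG(2,3,1)])
    fix s' q' assume "feasible P G s' q'"
    then show "\<mu> * makespan G s q \<le> makespan G s' q'"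
      using list_schedule_makespan_le[OF S(1,2)] mu S(3) by (simp add: field_simps)
  qed
  then show "makespan G s q \<le> 2 / (3 - sqrt 5) * opt_makespan P G"
    unfolding mu(5) using mu(1) by (simp add: field_simps)
qed

end
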